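(* For every $n\ge3$, the canonical splitting writes $\Lambda_n$ as a union of adjacent translates of $\Lambda_3,\Lambda_4,\Lambda_5$, and for all $n\ge0$ $$C(\Lambda_{2n+4})=\kappa^n(4),\qquad C(\Lambda_{2n+5})=\kappa^n(5),$$ where $\kappa$ is the morphism of the free monoid $\{3,4,5\}^*$ given by $\kappa(3)=5$, $\kappa(4)=434$, $\kappa(5)=545$.
   Context: Lucas numbers: $L_0=2$, $L_1=1$, $L_n=L_{n-1}+L_{n-2}$. Lucas intervals (integer intervals): $\Lambda_{2n}=[L_{2n},L_{2n+1}]$, $\Lambda_{2n+1}=[L_{2n+1}+1,L_{2n+2}-1]$ for $n\ge0$. For $n\ge6$, $\Lambda_n$ is the union of the three consecutive disjoint intervals $\Lambda_{n-2}+L_{n-1}$, $\Lambda_{n-3}+L_n$, $\Lambda_{n-2}+L_n$ (in this order), where $A+x=\{a+x:a\in A\}$. The canonical splitting of $\Lambda_n$ into translates of $\Lambda_3,\Lambda_4,\Lambda_5$ is defined recursively: for $n\in\{3,4,5\}$ it is $\Lambda_n$ itself; for $n\ge6$ it is obtained by translating the canonical splittings of $\Lambda_{n-2},\Lambda_{n-3},\Lambda_{n-2}$ to the three pieces above. $C(\Lambda_n)$ is the word over $\{3,4,5\}$ listing, from left to right, the indices $k$ of the successive translates of $\Lambda_k$ in the canonical splitting of $\Lambda_n$. *)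

theory Defs
  imports Main
begin

fun lucas :: "nat \<Rightarrow> int" where
  "lucas 0 = 2"
| "lucas (Suc 0) = 1"
| "lucas (Suc (Suc n)) = lucas (Suc n) + lucas n"

definition lucas_interval :: "nat \<Rightarrow> int set" where
  "lucas_interval n =
     (if even n then {lucas n .. lucas (n + 1)} else {lucas n + 1 .. lucas (n + 1) - 1})"

definition translate :: "int set \<Rightarrow> int \<Rightarrow> int set" where
  "translate A x = (\<lambda>a. a + x) ` A"

text \<open>
  A splitting is a list, from left to right, of pairs \<open>(k, x)\<close>; such a pair
  stands for the translate of \<open>lucas_interval k\<close> by \<open>x\<close>.
\<close>

type_synonym splitting = "(nat \<times> int) list"

definition piece :: "nat \<times> int \<Rightarrow> int set" where
  "piece p = translate (lucas_interval (fst p)) (snd p)"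

definition shift :: "int \<Rightarrow> splitting \<Rightarrow> splitting" where
  "shift y ps = map (\<lambda>(k, x). (k, x + y)) ps"

text \<open>The value for \<open>n < 3\<close> is a dummy: there the splitting is not defined.\<close>

function canonical_splitting :: "nat \<Rightarrow> splitting" where
  "canonical_splitting n =
     (if n < 3 then []
      else if n < 6 then [(n, 0)]
      else shift (lucas (n - 1)) (canonical_splitting (n - 2))
         @ shift (lucas n) (canonical_splitting (n - 3))
         @ shift (lucas n) (canonical_splitting (n - 2)))"
  by auto
termination by (relation "measure id") auto

declare canonical_splitting.simps [simp del]

definition splitting_word :: "nat \<Rightarrow> nat list" where
  "splitting_word n = map fst (canonical_splitting n)"

definition adjacent :: "int set \<Rightarrow> int set \<Rightarrow> bool" where
  "adjacent A B \<longleftrightarrow> (\<exists>a b c. a \<le> b \<and> b < c \<and> A = {a..b} \<and> B = {b + 1..c})"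

text \<open>
  Words over \<open>{3, 4, 5}\<close> are lists of natural numbers with entries in that set;
  the value on other letters is a dummy.
\<close>

definition kappa_letter :: "nat \<Rightarrow> nat list" where
  "kappa_letter k =
     (if k = 3 then [5] else if k = 4 then [4, 3, 4] else if k = 5 then [5, 4, 5] else [])"

definition kappa :: "nat list \<Rightarrow> nat list" where
  "kappa w = concat (map kappa_letter w)"

end

(* Writing each Lucas interval in half-open form {l n ..< l (n + 1)}, where l n is L_n plus 1 for
   odd n, the three pieces of Lambda_n fit together endpoint to endpoint by the Lucas recurrence,
   and chains of half-open intervals are stable under translation and concatenation.  The words
   satisfy C(Lambda_n) = C(Lambda_{n-2}) C(Lambda_{n-3}) C(Lambda_{n-2}); since kappa is a
   morphism, C(Lambda_{n+2}) = kappa (C(Lambda_n)) follows from the cases n = 3, 4, 5. *)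
theory Submission
  imports Defs
begin

definition lucas_start :: "nat \<Rightarrow> int" where
  "lucas_start n = lucas n + (if even n then 0 else 1)"

text \<open>The included right end for even \<open>n\<close> and the excluded one for odd
  \<open>n\<close> both become the start of the next Lucas interval, so no parity split is needed
  later.\<close>

lemma lucas_interval_eq: "lucas_interval n = {lucas_start n ..< lucas_start (n + 1)}"
  by (auto simp: lucas_interval_def lucas_start_def)

text \<open>Recording both endpoints lets chains compose. The strict \<open>c > a\<close> makes
  every piece nonempty, which \<open>adjacent\<close> demands.\<close>

fun tiles :: "int \<Rightarrow> splitting \<Rightarrow> int \<Rightarrow> bool" where
  "tiles a [] b \<longleftrightarrow> a = b"
| "tiles a (p # ps) b \<longleftrightarrow> (\<exists>c>a. piece p = {a..<c} \<and> tiles c ps b)"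

lemma tiles_append: "tiles a ps b \<Longrightarrow> tiles b qs c \<Longrightarrow> tiles a (ps @ qs) c"
  by (induction ps arbitrary: a) auto

lemma piece_shift: "piece (k, x + y) = (\<lambda>a. a + y) ` piece (k, x)"
  by (simp add: piece_def translate_def image_image add.assoc)

lemma tiles_shift: "tiles a ps b \<Longrightarrow> tiles (a + y) (shift y ps) (b + y)"
proof (induction ps arbitrary: a)
  case (Cons p ps)
  obtain k x where p: "p = (k, x)" by (cases p)
  from Cons.prems obtain c where c: "a < c" "piece p = {a..<c}" "tiles c ps b" by auto
  have "piece (k, x + y) = {a + y ..< c + y}"
    using c(2) by (simp add: piece_shift p)
  with c(1) Cons.IH[OF c(3)] show ?case
    by (auto simp: shift_def p intro!: exI[of _ "c + y"])
qed (simp add: shift_def)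

text \<open>Needed to glue \<open>{a..<c}\<close> and \<open>{c..<b}\<close> into
  \<open>{a..<b}\<close>, which requires \<open>c \<le> b\<close>.\<close>

lemma tiles_le: "tiles a ps b \<Longrightarrow> a \<le> b"
  by (induction ps arbitrary: a) force+

lemma tiles_Union: "tiles a ps b \<Longrightarrow> (\<Union>p\<in>set ps. piece p) = {a..<b}"
proof (induction ps arbitrary: a)
  case (Cons p ps)
  then obtain c where "a < c" "piece p = {a..<c}" "tiles c ps b" by auto
  then show ?case
    using Cons.IH[of c] tiles_le[of c ps b] by auto
qed simp

lemma adjacent_atLeastLessThan: "a < b \<Longrightarrow> b < c \<Longrightarrow> adjacent {a..<b} {b..<c}"
  unfolding adjacent_def
  \<comment> \<open>Over the integers, the closed right ends are one less than the half-open
    ones.\<close>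
  by (intro exI[of _ a] exI[of _ "b - 1"] exI[of _ "c - 1"]) auto

lemma tiles_successively_adjacent:
  "tiles a ps b \<Longrightarrow> successively adjacent (map piece ps)"
proof (induction ps arbitrary: a)
  case (Cons p ps)
  then obtain c where c: "a < c" "piece p = {a..<c}" "tiles c ps b" by auto
  show ?case
  \<comment> \<open>Only a second piece creates a new adjacency: it starts at \<open>c\<close>,
    where \<open>p\<close> ends.\<close>
  proof (cases ps)
    case (Cons q qs)
    with c show ?thesis
      using Cons.IH[OF c(3)] adjacent_atLeastLessThan by auto
  qed simp
qed simp

lemma canonical_splitting_base: "n \<in> {3, 4, 5} \<Longrightarrow> canonical_splitting n = [(n, 0)]"
  by (subst canonical_splitting.simps) auto

lemma canonical_splitting_rec:
  "canonical_splitting (n + 6) =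
     shift (lucas (n + 5)) (canonical_splitting (n + 4))
     @ shift (lucas (n + 6)) (canonical_splitting (n + 3))
     @ shift (lucas (n + 6)) (canonical_splitting (n + 4))"
  by (subst canonical_splitting.simps) (simp add: eval_nat_numeral)

text \<open>Matches the recursion of the splitting: \<open>n + 6\<close> calls \<open>n + 3\<close>
  and \<open>n + 4\<close>, both at least 3, so three base cases suffice.\<close>

lemma ge3_induct [consumes 1, case_names base step]:
  fixes n :: nat
  assumes "n \<ge> 3"
    and base: "\<And>n. n \<in> {3, 4, 5} \<Longrightarrow> P n"
    and step: "\<And>n. P (n + 3) \<Longrightarrow> P (n + 4) \<Longrightarrow> P (n + 6)"
  shows "P n"
  using \<open>n \<ge> 3\<close>
proof (induction n rule: less_induct)
  case (less n)
  show ?case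
  proof (cases "n < 6")
    case True
    with less.prems show ?thesis by (intro base) auto
  next
    case False
    then obtain m where "n = m + 6" by (metis add.commute le_Suc_ex not_less)
    with step[of m] less.IH show ?thesis by simp
  qed
qed

lemma tiles_canonical_splitting:
  "n \<ge> 3 \<Longrightarrow> tiles (lucas_start n) (canonical_splitting n) (lucas_start (n + 1))"
proof (induction n rule: ge3_induct)
  case (base n)
  then show ?case
    by (auto simp: canonical_splitting_base piece_def translate_def lucas_interval_eq
        lucas_start_def eval_nat_numeral)
next
  case (step n)
  have "lucas (n + 5) = lucas (n + 4) + lucas (n + 3)"
    "lucas (n + 6) = lucas (n + 5) + lucas (n + 4)"
    "lucas (n + 7) = lucas (n + 6) + lucas (n + 5)"
    by (simp_all add: eval_nat_numeral)
  \<comment> \<open>In order: the left end, the two inner seams (the second before its common shift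
    by \<open>lucas (n + 6)\<close>), and the right end. The parity corrections cancel, since the
    indices compared have equal parity.\<close>
  then have "lucas_start (n + 4) + lucas (n + 5) = lucas_start (n + 6)"
    "lucas_start (n + 4 + 1) + lucas (n + 5) = lucas_start (n + 3) + lucas (n + 6)"
    "lucas_start (n + 3 + 1) = lucas_start (n + 4)"
    "lucas_start (n + 4 + 1) + lucas (n + 6) = lucas_start (n + 6 + 1)"
    by (simp_all add: lucas_start_def add.commute[of _ n])
  then show ?case
    using tiles_shift[OF step(1), of "lucas (n + 6)"]
      tiles_shift[OF step(2), of "lucas (n + 5)"] tiles_shift[OF step(2), of "lucas (n + 6)"]
    unfolding canonical_splitting_rec by (auto intro!: tiles_append)
qed

lemma map_fst_shift: "map fst (shift y ps) = map fst ps"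
  by (induction ps) (auto simp: shift_def)

lemma splitting_word_base: "n \<in> {3, 4, 5} \<Longrightarrow> splitting_word n = [n]"
  by (simp add: splitting_word_def canonical_splitting_base)

lemma splitting_word_rec:
  "splitting_word (n + 6) =
     splitting_word (n + 4) @ splitting_word (n + 3) @ splitting_word (n + 4)"
  by (simp add: splitting_word_def canonical_splitting_rec map_fst_shift)

lemma set_splitting_word: "n \<ge> 3 \<Longrightarrow> set (splitting_word n) \<subseteq> {3, 4, 5}"
  by (induction n rule: ge3_induct) (auto simp: splitting_word_base splitting_word_rec)

lemma kappa_append: "kappa (u @ v) = kappa u @ kappa v"
  by (simp add: kappa_def)

lemma splitting_word_add_2: "n \<ge> 3 \<Longrightarrow> splitting_word (n + 2) = kappa (splitting_word n)"
proof (induction n rule: ge3_induct)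
  case (base n)
  \<comment> \<open>With the word \<open>[5]\<close> at index 5, these are exactly the images under
    \<open>kappa\<close> of the letters 3, 4 and 5.\<close>
  have "splitting_word 6 = [4, 3, 4]" "splitting_word 7 = [5, 4, 5]"
    using splitting_word_rec[of 0] splitting_word_rec[of 1] by (simp_all add: splitting_word_base)
  with base show ?case
    by (auto simp: splitting_word_base kappa_def kappa_letter_def)
next
  case (step n)
  \<comment> \<open>The recurrence two indices up, grouped so that the induction hypotheses pull
    \<open>kappa\<close> out of each factor.\<close>
  have "splitting_word (n + 6 + 2) =
      splitting_word (n + 4 + 2) @ splitting_word (n + 3 + 2) @ splitting_word (n + 4 + 2)"
    using splitting_word_rec[of "n + 2"] by (simp add: add.commute)
  then show ?case
    unfolding step.IH splitting_word_rec[of n] kappa_append .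
qed

text \<open>Each \<open>kappa\<close> raises the index by 2; the starts 4 and 5 then give the two
  parity classes.\<close>

lemma splitting_word_funpow:
  "n \<ge> 3 \<Longrightarrow> splitting_word (2 * m + n) = (kappa ^^ m) (splitting_word n)"
proof (induction m)
  case (Suc m)
  then show ?case
    using splitting_word_add_2[of "2 * m + n"] by (simp add: add.commute)
qed simp

theorem theorem4p1:
  "(\<forall>n\<ge>3. fst ` set (canonical_splitting n) \<subseteq> {3, 4, 5}
          \<and> (\<Union>p\<in>set (canonical_splitting n). piece p) = lucas_interval n
          \<and> successively adjacent (map piece (canonical_splitting n)))
   \<and> (\<forall>n. splitting_word (2 * n + 4) = (kappa ^^ n) [4]
         \<and> splitting_word (2 * n + 5) = (kappa ^^ n) [5])"
proof (intro conjI allI impI)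
  fix n :: nat assume n: "n \<ge> 3"
  show "fst ` set (canonical_splitting n) \<subseteq> {3, 4, 5}"
    using set_splitting_word[OF n] by (simp add: splitting_word_def)
  show "(\<Union>p\<in>set (canonical_splitting n). piece p) = lucas_interval n"
    using tiles_Union[OF tiles_canonical_splitting[OF n]] by (simp add: lucas_interval_eq)
  show "successively adjacent (map piece (canonical_splitting n))"
    by (rule tiles_successively_adjacent[OF tiles_canonical_splitting[OF n]])
next
  fix n :: nat
  show "splitting_word (2 * n + 4) = (kappa ^^ n) [4]"
    "splitting_word (2 * n + 5) = (kappa ^^ n) [5]"
    by (simp_all add: splitting_word_funpow splitting_word_base)
qed

end
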